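(* Let $c,n\in\mathbb{N}$ and let $\underline{\underline{P}}_{\theta}=\underline{\underline{T}}^{\mathsf H}\,\underline{\underline{Q}}\,\underline{\underline{T}}\in\mathbb{R}^{cn\times cn}$ be the UNO preconditioner matrix built from a local parametrization $\psi$ with values in the symmetric positive definite $c\times c$ matrices. Then $\underline{\underline{P}}_{\theta}$ is symmetric and positive definite. Moreover, let $\underline{\underline{A}}\in\mathbb{R}^{cn\times cn}$ be symmetric positive definite, $f\in\mathbb{R}^{cn}$, $u^{(0)}\in\mathbb{R}^{cn}$ arbitrary. Then the preconditioned conjugate gradient method with preconditioner $\underline{\underline{P}}_{\theta}$ (the UNO-CG solver), performed in exact arithmetic and stopped only when the residual vanishes, reaches after at most $cn$ iterations the exact solution $u\in\mathbb{R}^{cn}$ of $\underline{\underline{A}}\,u=f$.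
   Context: Here $c$ is the number of degrees of freedom per node, $n$ the number of nodes of a regular grid in dimension $d\in\mathbb{N}$, and $\mathsf H$ denotes the conjugate transpose. Parametrization. Let $C=c(c+1)/2$ and let $\psi:\mathbb{R}^{C}\to Sym_+(\mathbb{R}^{c\times c})$ be a map (local parametrization) into the symmetric positive definite real $c\times c$ matrices. Let $\mathcal{K}=\{k^{\langle 1\rangle},\dots,k^{\langle k_{\max}\rangle}\}\subset\mathbb{Z}^d$ be a finite set of distinct modes. For $k=(k_1,\dots,k_d)\in\mathbb{Z}^d$ put $\operatorname{conj}(k)=(k_1,\dots,k_{d-1},-k_d)$, and let $\mathcal{K}_{\rm c}$ be a (possibly empty) subset of $\{\operatorname{conj}(k):k\in\mathcal{K}\}\setminus\mathcal{K}$. The weight vector $\theta$ consists of $\theta^{\langle 0\rangle},\theta^{\langle 1\rangle},\dots,\theta^{\langle k_{\max}\rangle}\in\mathbb{R}^{C}$. Define $\widetilde{W}=\psi(\theta^{\langle 0\rangle})$ and $\widetilde{K}:\mathbb{Z}^d\to\mathbb{R}^{c\times c}$ by $\widetilde{K}(k)=\psi(\theta^{\langle j\rangle})$ if $k=k^{\langle j\rangle}\in\mathcal{K}$, $\widetilde{K}(k)=\psi(\theta^{\langle j\rangle})$ if $k=\operatorname{conj}(k^{\langle j\rangle})\in\mathcal{K}_{\rm c}$, and $\widetilde{K}(k)=0$ otherwise. Set $\widetilde{\Phi}(k)=\widetilde{W}+\widetilde{K}(k)$ for $k\in\mathbb{Z}^d$. Discretization. Let $q^{\langle 1\rangle},\dots,q^{\langle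 n\rangle}\in\mathbb{Z}^d$ be the (ordered) modes of the discrete grid with $n$ nodes, and put $\widetilde{\Phi}^{\langle i\rangle}=\widetilde{\Phi}(q^{\langle i\rangle})\in\mathbb{R}^{c\times c}$ with entries $\widetilde{\Phi}^{\langle i\rangle}_{lm}$. For $1\le l,m\le c$ let $D_{lm}=\operatorname{diag}(\widetilde{\Phi}^{\langle 1\rangle}_{lm},\dots,\widetilde{\Phi}^{\langle n\rangle}_{lm})\in\mathbb{R}^{n\times n}$, and let $\underline{\underline{Q}}\in\mathbb{R}^{cn\times cn}$ be the $c\times c$ block matrix whose $(l,m)$ block is $D_{lm}$. UNO preconditioner. The unitary transform used by the preconditioner is represented on the grid by a matrix $\underline{\underline{T}}\in\mathbb{C}^{cn\times cn}$ with $\underline{\underline{T}}^{-1}=\underline{\underline{T}}^{\mathsf H}$, and the UNO preconditioner matrix is $\underline{\underline{P}}_\theta=\underline{\underline{T}}^{\mathsf H}\,\underline{\underline{Q}}\,\underline{\underline{T}}$. Standing convention: $\mathcal{K}_{\rm c}$ is chosen, depending on the transform, such that $\underline{\underline{P}}_\theta$ maps real vectors to real vectors, i.e. $\underline{\underline{P}}_\theta\in\mathbb{R}^{cn\times cn}$. Preconditioned conjugate gradient method with preconditioner $\underline{\underline{P}}=\underline{\underline{P}}_\theta$. Initialize $u\leftarrow u^{(0)}$, $r\leftarrow f-\underline{\underline{A}}\,u^{(0)}$, $d\leftarrow 0\in\mathbb{R}^{cn}$, $\gamma_1\leftarrow 1$. While $r\neq 0$, perform one iteration: $s\leftarrow\underline{\underline{P}}\,r$;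 $\gamma_0\leftarrow\gamma_1$; $\gamma_1\leftarrow r\cdot s$; $d\leftarrow s+\frac{\gamma_1}{\gamma_0}d$; $p\leftarrow\underline{\underline{A}}\,d$; $\alpha\leftarrow\gamma_1/(d\cdot p)$; $r\leftarrow r-\alpha p$; $u\leftarrow u+\alpha d$. *)

theory Defs
  imports "Jordan_Normal_Form.Schur_Decomposition" "HOL-Library.FuncSet"
begin

definition spd_mat :: "nat \<Rightarrow> real mat set" where
  "spd_mat N = {M \<in> carrier_mat N N. M\<^sup>T = M \<and>
     (\<forall>x \<in> carrier_vec N. x \<noteq> 0\<^sub>v N \<longrightarrow> 0 < x \<bullet> (M *\<^sub>v x))}"

definition unitary_mat :: "nat \<Rightarrow> complex mat \<Rightarrow> bool" where
  "unitary_mat N T \<longleftrightarrow> T \<in> carrier_mat N N \<and>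
     inverts_mat T (mat_adjoint T) \<and> inverts_mat (mat_adjoint T) T"

definition conj_mode :: "int vec \<Rightarrow> int vec" where
  "conj_mode k = vec (dim_vec k) (\<lambda>i. if i = dim_vec k - 1 then - (k $ i) else k $ i)"

text \<open>The modes are \<open>ks 1, \<dots>, ks kmax\<close>, and \<open>\<theta> 0, \<dots>, \<theta> kmax\<close> are the components of the
  weight vector. The indices selected by \<open>THE\<close> are unique when \<open>ks\<close> is injective on
  \<open>{1..kmax}\<close>, since \<open>conj_mode\<close> is an involution.\<close>

definition K_tilde ::
  "nat \<Rightarrow> (real vec \<Rightarrow> real mat) \<Rightarrow> nat \<Rightarrow> (nat \<Rightarrow> int vec) \<Rightarrow> int vec set \<Rightarrow> (nat \<Rightarrow> real vec)
    \<Rightarrow> int vec \<Rightarrow> real mat" where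
  "K_tilde c \<psi> kmax ks Kc \<theta> k =
     (if k \<in> ks ` {1..kmax} then \<psi> (\<theta> (THE j. j \<in> {1..kmax} \<and> k = ks j))
      else if k \<in> Kc then \<psi> (\<theta> (THE j. j \<in> {1..kmax} \<and> k = conj_mode (ks j)))
      else 0\<^sub>m c c)"

definition Phi_tilde ::
  "nat \<Rightarrow> (real vec \<Rightarrow> real mat) \<Rightarrow> nat \<Rightarrow> (nat \<Rightarrow> int vec) \<Rightarrow> int vec set \<Rightarrow> (nat \<Rightarrow> real vec)
    \<Rightarrow> int vec \<Rightarrow> real mat" where
  "Phi_tilde c \<psi> kmax ks Kc \<theta> k = \<psi> (\<theta> 0) + K_tilde c \<psi> kmax ks Kc \<theta> k"

text \<open>The grid modes \<open>q 0, \<dots>, q (n - 1)\<close> and the block indices \<open>l, m < c\<close> are numbered from \<open>0\<close>, as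
  matrix entries are. Position \<open>a\<close> of a vector of length \<open>c * n\<close> lies in block \<open>a div n\<close> and has
  index \<open>a mod n\<close> there.\<close>

definition D_block :: "nat \<Rightarrow> (int vec \<Rightarrow> real mat) \<Rightarrow> (nat \<Rightarrow> int vec) \<Rightarrow> nat \<Rightarrow> nat \<Rightarrow> real mat" where
  "D_block n \<Phi> q l m = mat_diag n (\<lambda>i. \<Phi> (q i) $$ (l, m))"

definition Q_mat :: "nat \<Rightarrow> nat \<Rightarrow> (int vec \<Rightarrow> real mat) \<Rightarrow> (nat \<Rightarrow> int vec) \<Rightarrow> real mat" where
  "Q_mat c n \<Phi> q = mat (c * n) (c * n)
     (\<lambda>(a, b). D_block n \<Phi> q (a div n) (b div n) $$ (a mod n, b mod n))"

definition UNO_precond :: "complex mat \<Rightarrow> real mat \<Rightarrow> complex mat" where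
  "UNO_precond T Q = mat_adjoint T * map_mat complex_of_real Q * T"

text \<open>The state of the preconditioned conjugate gradient method is \<open>(u, r, d, \<gamma>\<^sub>1)\<close>. Division is
  total in HOL, so an iteration is only admitted if neither divisor vanishes: a breakdown of the
  method is a state with \<open>r \<noteq> 0\<close> and no successor.\<close>

type_synonym pcg_state = "real vec \<times> real vec \<times> real vec \<times> real"

definition pcg_init :: "nat \<Rightarrow> real mat \<Rightarrow> real vec \<Rightarrow> real vec \<Rightarrow> pcg_state" where
  "pcg_init N A f u0 = (u0, f - A *\<^sub>v u0, 0\<^sub>v N, 1)"

inductive pcg_iteration :: "real mat \<Rightarrow> real mat \<Rightarrow> pcg_state \<Rightarrow> pcg_state \<Rightarrow> bool"
  for A P :: "real mat" where
  "\<lbrakk> r \<noteq> 0\<^sub>v (dim_vec r);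
     s = P *\<^sub>v r;
     \<gamma>\<^sub>1 = r \<bullet> s;
     \<gamma>\<^sub>0 \<noteq> 0;
     d' = s + (\<gamma>\<^sub>1 / \<gamma>\<^sub>0) \<cdot>\<^sub>v d;
     p = A *\<^sub>v d';
     d' \<bullet> p \<noteq> 0;
     \<alpha> = \<gamma>\<^sub>1 / (d' \<bullet> p) \<rbrakk>
   \<Longrightarrow> pcg_iteration A P (u, r, d, \<gamma>\<^sub>0) (u + \<alpha> \<cdot>\<^sub>v d', r - \<alpha> \<cdot>\<^sub>v p, d', \<gamma>\<^sub>1)"

lemma pcg_iteration_deterministic:
  "pcg_iteration A P st st1 \<Longrightarrow> pcg_iteration A P st st2 \<Longrightarrow> st1 = st2"
  by (auto elim!: pcg_iteration.cases)

end

theory Submission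
  imports Defs
begin

text \<open>\<open>Q\<close> is, up to reordering the unknowns by node, block diagonal with symmetric positive definite
  blocks. Writing \<open>T = B + \<i> C\<close> with real \<open>B\<close> and \<open>C\<close>, the real part of \<open>T\<^sup>H Q T\<close> is
  \<open>B\<^sup>T Q B + C\<^sup>T Q C\<close>, and \<open>B\<^sup>T B + C\<^sup>T C = 1\<close>; this gives positive definiteness of \<open>P\<close>. As long
  as no residual has vanished, the search directions of the conjugate gradient method are nonzero
  and \<open>A\<close>-orthogonal, and the current residual is orthogonal to all of them. After \<open>N\<close> steps they form
  a basis, so the residual is zero.\<close>

subsection \<open>Symmetric positive definite matrices\<close>

lemma spd_mat_carrier: "M \<in> spd_mat N \<Longrightarrow> M \<in> carrier_mat N N"
  by (simp add: spd_mat_def)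

lemma spd_mat_pos:
  "M \<in> spd_mat N \<Longrightarrow> x \<in> carrier_vec N \<Longrightarrow> x \<noteq> 0\<^sub>v N \<Longrightarrow> 0 < x \<bullet> (M *\<^sub>v x)"
  by (simp add: spd_mat_def)

lemma spd_mat_nonneg:
  assumes "M \<in> spd_mat N" "x \<in> carrier_vec N"
  shows "0 \<le> x \<bullet> (M *\<^sub>v x)"
proof (cases "x = 0\<^sub>v N")
  case True
  then show ?thesis using spd_mat_carrier[OF assms(1)] by simp
qed (use spd_mat_pos[OF assms] in simp)

lemma spd_mat_scalar_prod_commute:
  assumes M: "M \<in> spd_mat N" and x: "x \<in> carrier_vec N" and y: "y \<in> carrier_vec N"
  shows "x \<bullet> (M *\<^sub>v y) = y \<bullet> (M *\<^sub>v x)"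
proof -
  have C: "M \<in> carrier_mat N N" and S: "M\<^sup>T = M" using M by (auto simp: spd_mat_def)
  have "x \<bullet> (M *\<^sub>v y) = (M\<^sup>T *\<^sub>v x) \<bullet> y"
    using transpose_vec_mult_scalar[OF C y x] by simp
  also have "\<dots> = y \<bullet> (M *\<^sub>v x)"
    unfolding S using C x y by (intro comm_scalar_prod[of _ N]) auto
  finally show ?thesis .
qed

lemma spd_mat_mult_eq_zero:
  assumes M: "M \<in> spd_mat N" and x: "x \<in> carrier_vec N" and "M *\<^sub>v x = 0\<^sub>v N"
  shows "x = 0\<^sub>v N"
  using spd_mat_pos[OF M x] assms(3) x by fastforce

lemma spd_mat_add:
  assumes A: "A \<in> spd_mat N" and B: "B \<in> spd_mat N"
  shows "A + B \<in> spd_mat N"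
proof -
  have C: "A \<in> carrier_mat N N" "B \<in> carrier_mat N N" "A\<^sup>T = A" "B\<^sup>T = B"
    using A B by (auto simp: spd_mat_def)
  have "0 < x \<bullet> ((A + B) *\<^sub>v x)" if x: "x \<in> carrier_vec N" "x \<noteq> 0\<^sub>v N" for x
  proof -
    have "x \<bullet> ((A + B) *\<^sub>v x) = x \<bullet> (A *\<^sub>v x) + x \<bullet> (B *\<^sub>v x)"
      using C x by (simp add: add_mult_distrib_mat_vec[of _ N N] scalar_prod_add_distrib[of _ N])
    then show ?thesis using spd_mat_pos[OF A x] spd_mat_pos[OF B x] by simp
  qed
  moreover have "(A + B)\<^sup>T = A + B"
    using C transpose_add[of A N N B] by simp
  ultimately show ?thesis using C by (simp add: spd_mat_def)
qed

text \<open>If the rows of \<open>M\<close> are the vectors \<open>v i\<close>, then \<open>M A M\<^sup>T\<close> is diagonal with nonzero diagonal,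
  so \<open>M\<close> is invertible.\<close>

lemma orthogonal_to_conjugate_basis_eq_zero:
  assumes A: "A \<in> spd_mat N" and v: "\<And>i. i < N \<Longrightarrow> v i \<in> carrier_vec N"
    and nz: "\<And>i. i < N \<Longrightarrow> v i \<noteq> 0\<^sub>v N"
    and orth: "\<And>i j. i < N \<Longrightarrow> j < N \<Longrightarrow> i \<noteq> j \<Longrightarrow> v i \<bullet> (A *\<^sub>v v j) = 0"
    and x: "x \<in> carrier_vec N" and vx: "\<And>i. i < N \<Longrightarrow> v i \<bullet> x = 0"
  shows "x = 0\<^sub>v N"
proof (rule ccontr)
  assume xnz: "x \<noteq> 0\<^sub>v N"
  note CA = spd_mat_carrier[OF A]
  define M where "M = mat N N (\<lambda>(i, j). v i $ j)"
  have M: "M \<in> carrier_mat N N" by (simp add: M_def)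
  have row: "row M i = v i" if "i < N" for i
    using v[OF that] that by (auto simp: M_def)
  have "M *\<^sub>v x = 0\<^sub>v N"
    using M vx row by (intro eq_vecI) auto
  then have "det M = 0"
    using det_0_iff_vec_prod_zero_field[OF M] x xnz by blast
  define G where "G = M * (A * M\<^sup>T)"
  have G: "G \<in> carrier_mat N N" using M CA by (simp add: G_def)
  have "det G = det M * det (A * M\<^sup>T)"
    unfolding G_def using M CA by (intro det_mult[of _ N]) auto
  then have "det G = 0" using \<open>det M = 0\<close> by simp
  have Gij: "G $$ (i, j) = v i \<bullet> (A *\<^sub>v v j)" if "i < N" "j < N" for i j
  proof -
    have "col (A * M\<^sup>T) j = A *\<^sub>v v j"
      using that M CA row by (subst col_mult2[of _ N N _ N]) auto
    then show ?thesis using that M CA row by (simp add: G_def)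
  qed
  \<comment> \<open>Conjugacy makes \<open>G\<close>, the Gram matrix of the \<open>v i\<close> in
    the inner product of \<open>A\<close>, diagonal. Its determinant is then a product of positive
    energies.\<close>
  have "upper_triangular G"
    using G Gij orth by (auto simp: upper_triangular_def)
  then have "det G = prod_list (diag_mat G)"
    by (rule det_upper_triangular[OF _ G])
  moreover have "0 \<notin> set (diag_mat G)"
    using G Gij spd_mat_pos[OF A v nz] by (force simp: diag_mat_def)
  ultimately show False using \<open>det G = 0\<close> by (simp add: prod_list_zero_iff)
qed

subsection \<open>Termination of the preconditioned conjugate gradient method\<close>

text \<open>A total version of one iteration, with division by zero allowed, so that the iterates
  form sequences over all natural numbers. That the steps are admissible is shown afterwards, in
  \<open>pcg_iteration_state\<close>.\<close>

definition pcg_step :: "real mat \<Rightarrow> real mat \<Rightarrow> pcg_state \<Rightarrow> pcg_state" where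
  "pcg_step A P = (\<lambda>(u, r, d, \<gamma>).
     let s = P *\<^sub>v r; \<gamma>' = r \<bullet> s; d' = s + (\<gamma>' / \<gamma>) \<cdot>\<^sub>v d; p = A *\<^sub>v d'; \<alpha> = \<gamma>' / (d' \<bullet> p)
     in (u + \<alpha> \<cdot>\<^sub>v d', r - \<alpha> \<cdot>\<^sub>v p, d', \<gamma>'))"

lemma pcg_iteration_pcg_step:
  assumes "r \<noteq> 0\<^sub>v (dim_vec r)" "\<gamma> \<noteq> 0"
    and "pcg_step A P (u, r, d, \<gamma>) = (u', r', d', \<gamma>')" "d' \<bullet> (A *\<^sub>v d') \<noteq> 0"
  shows "pcg_iteration A P (u, r, d, \<gamma>) (u', r', d', \<gamma>')"
  using assms unfolding pcg_step_def Let_def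
  by (auto intro!: pcg_iteration.intros)

section \<open>The iterates as sequences and their recurrences\<close>

locale spd_pcg =
  fixes N :: nat and A P :: "real mat" and f u0 :: "real vec"
  assumes A: "A \<in> spd_mat N" and P: "P \<in> spd_mat N"
    and f: "f \<in> carrier_vec N" and u0: "u0 \<in> carrier_vec N"
begin

definition state :: "nat \<Rightarrow> pcg_state" where
  "state k = (pcg_step A P ^^ k) (pcg_init N A f u0)"

definition sol :: "nat \<Rightarrow> real vec" where "sol k = fst (state k)"
definition res :: "nat \<Rightarrow> real vec" where "res k = fst (snd (state k))"
definition dir :: "nat \<Rightarrow> real vec" where "dir k = fst (snd (snd (state k)))"
definition gam :: "nat \<Rightarrow> real" where "gam k = snd (snd (snd (state k)))"
text \<open>Indexed by the state that a step produces: passing from \<open>state k\<close> to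
  \<open>state (Suc k)\<close> uses \<open>stepsize (Suc k)\<close>, because direction and
  \<open>gam\<close> are updated first. The value at 0, a division by zero, never enters an
  iterate.\<close>

definition stepsize :: "nat \<Rightarrow> real" where
  "stepsize k = gam k / (dir k \<bullet> (A *\<^sub>v dir k))"

lemmas state_defs = sol_def res_def dir_def gam_def

lemma state_eq: "state k = (sol k, res k, dir k, gam k)"
  by (simp add: state_defs)

lemma init:
  "sol 0 = u0" "res 0 = f - A *\<^sub>v u0" "dir 0 = 0\<^sub>v N" "gam 0 = 1"
  by (simp_all add: state_defs state_def pcg_init_def)

lemma state_Suc: "state (Suc k) = pcg_step A P (sol k, res k, dir k, gam k)"
  by (simp add: state_eq[symmetric]) (simp add: state_def)

lemma step:
  "gam (Suc k) = res k \<bullet> (P *\<^sub>v res k)"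
  "dir (Suc k) = P *\<^sub>v res k + (gam (Suc k) / gam k) \<cdot>\<^sub>v dir k"
  "res (Suc k) = res k - stepsize (Suc k) \<cdot>\<^sub>v (A *\<^sub>v dir (Suc k))"
  "sol (Suc k) = sol k + stepsize (Suc k) \<cdot>\<^sub>v dir (Suc k)"
  using state_Suc[of k] unfolding state_eq[of "Suc k"] pcg_step_def Let_def stepsize_def
  by auto

lemma A_carrier: "A \<in> carrier_mat N N" and P_carrier: "P \<in> carrier_mat N N"
  using A P by (auto dest: spd_mat_carrier)

lemma carriers: "sol k \<in> carrier_vec N \<and> res k \<in> carrier_vec N \<and> dir k \<in> carrier_vec N"
proof (induction k)
  case 0
  then show ?case using A_carrier f u0 by (simp add: init)
next
  case (Suc k)
  have "dir (Suc k) \<in> carrier_vec N"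
    using Suc A_carrier P_carrier by (simp add: step(2))
  then show ?case
    using Suc A_carrier by (simp add: step(3,4))
qed

lemma sol_carrier [simp]: "sol k \<in> carrier_vec N"
  and res_carrier [simp]: "res k \<in> carrier_vec N"
  and dir_carrier [simp]: "dir k \<in> carrier_vec N"
  using carriers by auto

lemma mult_carrier [simp]:
  "x \<in> carrier_vec N \<Longrightarrow> A *\<^sub>v x \<in> carrier_vec N"
  "x \<in> carrier_vec N \<Longrightarrow> P *\<^sub>v x \<in> carrier_vec N"
  using A_carrier P_carrier by auto

lemma res_eq: "res k = f - A *\<^sub>v sol k"
proof (induction k)
  case 0
  then show ?case by (simp add: init)
next
  case (Suc k)
  have "A *\<^sub>v sol (Suc k) = A *\<^sub>v sol k + stepsize (Suc k) \<cdot>\<^sub>v (A *\<^sub>v dir (Suc k))"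
    unfolding step(4)
    by (simp add: mult_add_distrib_mat_vec[OF A_carrier] mult_mat_vec[OF A_carrier])
  moreover have "dim_vec (A *\<^sub>v dir (Suc k)) = N" "dim_vec (A *\<^sub>v sol k) = N" "dim_vec f = N"
    using A_carrier f by auto
  ultimately show ?case
    unfolding step(3)[of k] Suc by (intro eq_vecI) auto
qed

lemma scalar_prod_dir_Suc:
  assumes "x \<in> carrier_vec N"
  shows "x \<bullet> dir (Suc k) = x \<bullet> (P *\<^sub>v res k) + gam (Suc k) / gam k * (x \<bullet> dir k)"
  unfolding step(2) using assms
  by (simp add: scalar_prod_add_distrib[of _ N] scalar_prod_smult_distrib[of _ N])

lemma scalar_prod_res_Suc:
  assumes "x \<in> carrier_vec N"
  shows "x \<bullet> res (Suc k) = x \<bullet> res k - stepsize (Suc k) * (x \<bullet> (A *\<^sub>v dir (Suc k)))"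
  unfolding step(3) using assms
  by (simp add: scalar_prod_minus_distrib[of _ N] scalar_prod_smult_distrib[of _ N])

section \<open>Orthogonality of residuals and conjugacy of directions\<close>

lemma res_comm: "res j \<bullet> dir i = dir i \<bullet> res j"
  by (rule comm_scalar_prod[of _ N]) simp_all

lemma A_comm: "dir i \<bullet> (A *\<^sub>v dir j) = dir j \<bullet> (A *\<^sub>v dir i)"
  by (rule spd_mat_scalar_prod_commute[OF A]) simp_all

lemma P_comm: "res i \<bullet> (P *\<^sub>v res j) = res j \<bullet> (P *\<^sub>v res i)"
  by (rule spd_mat_scalar_prod_commute[OF P]) simp_all

text \<open>At 0 this is the initial value 1, later the squared \<open>P\<close>-norm of a nonzero
  residual. It makes the quotient of successive values of \<open>gam\<close> a genuine
  division.\<close>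

lemma gam_pos:
  assumes "\<And>j. j < k \<Longrightarrow> res j \<noteq> 0\<^sub>v N"
  shows "0 < gam k"
  using assms by (cases k) (auto simp: init step(1) intro: spd_mat_pos[OF P])

text \<open>Excludes breakdown: the old direction contributes nothing to the product of
  \<open>res k\<close> with \<open>dir (Suc k)\<close>, which is therefore the squared
  \<open>P\<close>-norm of \<open>res k\<close>. So the new direction cannot be zero.\<close>

lemma dir_energy_pos:
  assumes "res k \<noteq> 0\<^sub>v N" "res k \<bullet> dir k = 0"
  shows "0 < dir (Suc k) \<bullet> (A *\<^sub>v dir (Suc k))"
proof -
  have "res k \<bullet> dir (Suc k) = gam (Suc k)"
    by (simp add: scalar_prod_dir_Suc assms(2) step(1))
  also have "\<dots> > 0"
    using spd_mat_pos[OF P _ assms(1)] by (simp add: step(1))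
  finally have "dir (Suc k) \<noteq> 0\<^sub>v N" by auto
  then show ?thesis by (intro spd_mat_pos[OF A]) simp_all
qed

text \<open>The preconditioned residual at \<open>j\<close> is a linear combination of
  \<open>dir (Suc j)\<close> and \<open>dir j\<close>.\<close>

lemma res_P_orthogonal:
  assumes "\<And>i. i \<le> Suc j \<Longrightarrow> res k \<bullet> dir i = 0"
  shows "res k \<bullet> (P *\<^sub>v res j) = 0"
  using scalar_prod_dir_Suc[of "res k" j] assms[of j] assms[of "Suc j"] by simp

text \<open>The two claims need a joint induction. Orthogonality of residuals to directions makes
  the residuals \<open>P\<close>-orthogonal; this yields conjugacy of the new direction, which in
  turn yields orthogonality of the new residual. Only residuals before \<open>m\<close> must be
  nonzero, so \<open>res m\<close> may already vanish.\<close>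

lemma orthogonality:
  assumes "\<And>j. j < m \<Longrightarrow> res j \<noteq> 0\<^sub>v N"
  shows "(\<forall>j\<le>m. \<forall>i\<le>j. res j \<bullet> dir i = 0) \<and> (\<forall>j\<le>m. \<forall>i<j. dir i \<bullet> (A *\<^sub>v dir j) = 0)"
  using assms
proof (induction m)
  case 0
  then show ?case by (simp add: init(3))
next
  case (Suc m)
  then have RD: "res j \<bullet> dir i = 0" if "i \<le> j" "j \<le> m" for i j using that by auto
  have DD: "dir i \<bullet> (A *\<^sub>v dir j) = 0" if "i < j" "j \<le> m" for i j using Suc that by auto
  have gpos: "0 < gam j" if "j \<le> Suc m" for j
    using Suc.prems that by (intro gam_pos) auto
  have dpos: "0 < dir (Suc j) \<bullet> (A *\<^sub>v dir (Suc j))" if "j \<le> m" for j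
    using Suc.prems that RD by (intro dir_energy_pos) auto
  have spos: "0 < stepsize (Suc j)" if "j \<le> m" for j
    unfolding stepsize_def using dpos gpos that by (intro divide_pos_pos) auto
  have RP: "res m \<bullet> (P *\<^sub>v res i) = 0" if "i < m" for i
    using that by (intro res_P_orthogonal RD) auto
  have DA: "dir i \<bullet> (A *\<^sub>v dir (Suc m)) = 0" if i: "i \<le> m" for i
  proof (cases i)
    case 0
    then show ?thesis by (simp add: init(3))
  next
    case (Suc l)
    let ?s = "stepsize (Suc l)"
    \<comment> \<open>Pairing the residual recurrence that produces \<open>res i\<close> with the
      preconditioned \<open>res m\<close> expresses the unknown product with \<open>A\<close>
      applied to \<open>dir i\<close> through \<open>P\<close>-products of residuals.\<close>
    have "(P *\<^sub>v res m) \<bullet> res (Suc l) =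
        (P *\<^sub>v res m) \<bullet> res l - ?s * ((P *\<^sub>v res m) \<bullet> (A *\<^sub>v dir i))"
      using Suc by (simp add: scalar_prod_res_Suc)
    moreover have "(P *\<^sub>v res m) \<bullet> res j = res m \<bullet> (P *\<^sub>v res j)" for j
      using comm_scalar_prod[of "P *\<^sub>v res m" N "res j"] P_comm[of j m] by simp
    ultimately have *: "?s * ((P *\<^sub>v res m) \<bullet> (A *\<^sub>v dir i)) =
        - (res m \<bullet> (P *\<^sub>v res (Suc l)))"
      using RP[of l] i Suc by simp
    have **: "dir i \<bullet> (A *\<^sub>v dir (Suc m)) =
        (P *\<^sub>v res m) \<bullet> (A *\<^sub>v dir i) + gam (Suc m) / gam m * (dir m \<bullet> (A *\<^sub>v dir i))"
    proof -
      have "dir i \<bullet> (A *\<^sub>v dir (Suc m)) = (A *\<^sub>v dir i) \<bullet> dir (Suc m)"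
        unfolding A_comm[of i] by (rule comm_scalar_prod[of _ N]) simp_all
      also have "\<dots> = (A *\<^sub>v dir i) \<bullet> (P *\<^sub>v res m) +
          gam (Suc m) / gam m * ((A *\<^sub>v dir i) \<bullet> dir m)"
        by (rule scalar_prod_dir_Suc) simp
      finally show ?thesis
        using comm_scalar_prod[of "A *\<^sub>v dir i" N] by simp
    qed
    show ?thesis
    proof (cases "i = m")
      \<comment> \<open>Here \<open>l\<close> and \<open>Suc l\<close> both lie below
        \<open>m\<close>, so both \<open>P\<close>-products of residuals vanish.\<close>
      case False
      then have "?s * ((P *\<^sub>v res m) \<bullet> (A *\<^sub>v dir i)) = 0"
        using * RP[of i] i Suc by simp
      then have "(P *\<^sub>v res m) \<bullet> (A *\<^sub>v dir i) = 0"
        using spos[of l] i Suc by simp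
      moreover have "dir m \<bullet> (A *\<^sub>v dir i) = 0"
        using DD[of i m] False i A_comm by simp
      ultimately show ?thesis using ** by simp
    next
      \<comment> \<open>Now \<open>res (Suc l)\<close> is \<open>res m\<close> itself and its
        squared \<open>P\<close>-norm \<open>gam (Suc m)\<close> survives. Inserting the definition
        of \<open>stepsize m\<close> shows that the coefficient \<open>gam (Suc m) / gam m\<close>
        of the old direction cancels it exactly.\<close>
      case True
      then have "?s * ((P *\<^sub>v res m) \<bullet> (A *\<^sub>v dir i)) = - gam (Suc m)"
        using * Suc by (simp add: step(1)[of m])
      then have "(P *\<^sub>v res m) \<bullet> (A *\<^sub>v dir i) = - gam (Suc m) / ?s"
        using spos[of l] i Suc by (simp add: field_simps)
      also have "\<dots> = - (gam (Suc m) / gam m * (dir m \<bullet> (A *\<^sub>v dir i)))"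
        using True Suc by (simp add: stepsize_def)
      finally show ?thesis using ** by simp
    qed
  qed
  have RDm: "res (Suc m) \<bullet> dir i = 0" if i: "i \<le> Suc m" for i
  proof (cases "i = Suc m")
    case False
    then show ?thesis
      using i DA RD[of i m] unfolding res_comm by (simp add: scalar_prod_res_Suc)
  next
    case True
    \<comment> \<open>Hence the step size is the one that removes from \<open>res m\<close> its
      component along the new direction.\<close>
    have "dir (Suc m) \<bullet> res m = gam (Suc m)"
      using RD[of m m] scalar_prod_dir_Suc[of "res m" m]
      by (simp add: res_comm[symmetric] step(1))
    then show ?thesis
      unfolding res_comm True scalar_prod_res_Suc[OF dir_carrier] stepsize_def
      using dpos[of m] by simp
  qed
  show ?case
    using RD DD DA RDm by (auto simp: le_Suc_eq)
qed

section \<open>Termination within \<open>N\<close> admissible steps\<close>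

lemma exists_zero_residual: "\<exists>m\<le>N. res m = 0\<^sub>v N"
proof (rule ccontr)
  assume "\<not> ?thesis"
  then have nz: "res j \<noteq> 0\<^sub>v N" if "j \<le> N" for j using that by auto
  have o: "\<forall>j\<le>N. \<forall>i\<le>j. res j \<bullet> dir i = 0" "\<forall>j\<le>N. \<forall>i<j. dir i \<bullet> (A *\<^sub>v dir j) = 0"
    using orthogonality[of N] nz by auto
  have "res N = 0\<^sub>v N"
  \<comment> \<open>The shift by one skips the artificial initial direction \<open>dir 0\<close>,
    which is zero.\<close>
  proof (rule orthogonal_to_conjugate_basis_eq_zero[OF A, of "\<lambda>i. dir (Suc i)"])
    fix i assume i: "i < N"
    then have "0 < dir (Suc i) \<bullet> (A *\<^sub>v dir (Suc i))"
      using nz o by (intro dir_energy_pos) auto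
    then show "dir (Suc i) \<noteq> 0\<^sub>v N" by auto
    show "dir (Suc i) \<bullet> res N = 0"
      using o i by (simp add: res_comm[symmetric])
  next
    fix i j assume "i < N" "j < N" "i \<noteq> j"
    then show "dir (Suc i) \<bullet> (A *\<^sub>v dir (Suc j)) = 0"
      using o(2) A_comm by (metis Suc_leI Suc_less_eq nat_neq_iff)
  qed simp_all
  then show False using nz by simp
qed

text \<open>Carries the total sequence back to the guarded relation: before the first zero residual
  both divisors, \<open>gam\<close> and the energy of the new direction, are positive.\<close>

lemma pcg_iteration_state:
  assumes "\<And>j. j < m \<Longrightarrow> res j \<noteq> 0\<^sub>v N"
  shows "(pcg_iteration A P ^^ m) (pcg_init N A f u0) (state m)"
  using assms
proof (induction m)
  case 0
  then show ?case by (simp add: state_def)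
next
  case (Suc m)
  have "res m \<bullet> dir m = 0" using orthogonality[of m] Suc.prems by simp
  then have "0 < dir (Suc m) \<bullet> (A *\<^sub>v dir (Suc m))"
    using Suc.prems by (intro dir_energy_pos) auto
  moreover have "0 < gam m" using Suc.prems by (intro gam_pos) auto
  moreover have "res m \<noteq> 0\<^sub>v (dim_vec (res m))"
    using Suc.prems[of m] carrier_vecD[OF res_carrier[of m]] by (metis lessI)
  ultimately have "pcg_iteration A P (state m) (state (Suc m))"
    unfolding state_eq using state_Suc[of m] state_eq[of "Suc m"]
    by (intro pcg_iteration_pcg_step) auto
  moreover have "(pcg_iteration A P ^^ m) (pcg_init N A f u0) (state m)"
    using Suc by simp
  ultimately show ?case by auto
qed

text \<open>The recursively computed residual is the true one by \<open>res_eq\<close>, which gives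
  existence; definiteness of \<open>A\<close> gives uniqueness.\<close>

lemma solution_unique:
  assumes "res m = 0\<^sub>v N"
  shows "{v \<in> carrier_vec N. A *\<^sub>v v = f} = {sol m}"
proof -
  have fA: "f = A *\<^sub>v sol m"
  proof (intro eq_vecI)
    fix i assume i: "i < dim_vec (A *\<^sub>v sol m)"
    have "(f - A *\<^sub>v sol m) $ i = 0" using i A_carrier assms res_eq[of m] by simp
    then show "f $ i = (A *\<^sub>v sol m) $ i" using i by simp
  qed (use f A_carrier in auto)
  have "v = sol m" if v: "v \<in> carrier_vec N" "A *\<^sub>v v = f" for v
  proof -
    have "A *\<^sub>v (v - sol m) = 0\<^sub>v N"
      using v fA f by (simp add: mult_minus_distrib_mat_vec[OF A_carrier])
    then have "v - sol m = 0\<^sub>v N"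
      using spd_mat_mult_eq_zero[OF A minus_carrier_vec[OF v(1) sol_carrier]] by blast
    moreover have dim: "dim_vec (sol m) = N" "dim_vec v = N" using v(1) carriers by auto
    ultimately have "v $ i - sol m $ i = 0" if "i < N" for i
      using that index_minus_vec(1)[of i "sol m" v, unfolded dim(1)] by simp
    then show ?thesis by (intro eq_vecI) (simp_all only: dim right_minus_eq)
  qed
  then show ?thesis using fA by auto
qed

lemma pcg_terminates:
  "\<exists>m\<le>N. \<exists>u r d \<gamma>. (pcg_iteration A P ^^ m) (pcg_init N A f u0) (u, r, d, \<gamma>) \<and>
     r = 0\<^sub>v N \<and> {v \<in> carrier_vec N. A *\<^sub>v v = f} = {u}"
proof -
  \<comment> \<open>With the least such index all earlier residuals are nonzero, so every iteration
    up to \<open>m\<close> passes its guards.\<close>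
  define m where "m = (LEAST m. res m = 0\<^sub>v N)"
  obtain k where "k \<le> N" "res k = 0\<^sub>v N" using exists_zero_residual by blast
  then have "m \<le> N" "res m = 0\<^sub>v N"
    unfolding m_def by (auto intro: LeastI Least_le order_trans)
  moreover have "(pcg_iteration A P ^^ m) (pcg_init N A f u0) (state m)"
    unfolding m_def by (intro pcg_iteration_state) (auto dest: not_less_Least)
  ultimately show ?thesis using solution_unique[of m] unfolding state_eq by blast
qed

end

subsection \<open>The preconditioner matrix\<close>

text \<open>The cross terms between real and imaginary part of \<open>T\<close> carry a factor \<i>,
  and \<open>M\<close> is real, so they drop out of the real part.\<close>

lemma Re_adjoint_congruence:
  fixes T :: "complex mat" and M :: "real mat"
  assumes T: "T \<in> carrier_mat N N" and M: "M \<in> carrier_mat N N"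
  shows "map_mat Re (mat_adjoint T * map_mat complex_of_real M * T) =
    (map_mat Re T)\<^sup>T * M * map_mat Re T + (map_mat Im T)\<^sup>T * M * map_mat Im T"
proof (rule eq_matI)
  have adj: "mat_adjoint T \<in> carrier_mat N N"
    "\<And>i j. i < N \<Longrightarrow> j < N \<Longrightarrow> mat_adjoint T $$ (i, j) = cnj (T $$ (j, i))"
    using T by (auto simp: mat_adjoint_def mat_of_rows_def)
  let ?R = "(map_mat Re T)\<^sup>T * M * map_mat Re T + (map_mat Im T)\<^sup>T * M * map_mat Im T"
  fix i j assume "i < dim_row ?R" "j < dim_col ?R"
  then have ij: "i < N" "j < N" using T by auto
  then show "map_mat Re (mat_adjoint T * map_mat complex_of_real M * T) $$ (i, j) = ?R $$ (i, j)"
    using T M adj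
    by (simp add: scalar_prod_def Re_sum Im_sum sum_negf sum.distrib)
qed (use T in \<open>auto simp: mat_adjoint_def\<close>)

lemma spd_mat_unitary_congruence:
  assumes T: "unitary_mat N T" and M: "M \<in> spd_mat N"
    and P: "map_mat complex_of_real P = UNO_precond T M"
  shows "P \<in> spd_mat N"
proof -
  have TC: "T \<in> carrier_mat N N" using T by (simp add: unitary_mat_def)
  have TT: "mat_adjoint T * T = 1\<^sub>m N"
    using T TC by (auto simp: unitary_mat_def inverts_mat_def mat_adjoint_def)
  have MC: "M \<in> carrier_mat N N" and MT: "M\<^sup>T = M" using M by (auto simp: spd_mat_def)
  define B where "B = map_mat Re T"
  define C where "C = map_mat Im T"
  have BC: "B \<in> carrier_mat N N" "C \<in> carrier_mat N N" using TC by (auto simp: B_def C_def)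
  \<comment> \<open>\<open>P\<close> is real by hypothesis, so it coincides with the real part of
    the complex product.\<close>
  have "P = map_mat Re (map_mat complex_of_real P)" by (intro eq_matI) auto
  also have "\<dots> = B\<^sup>T * M * B + C\<^sup>T * M * C"
    unfolding P UNO_precond_def B_def C_def by (rule Re_adjoint_congruence[OF TC MC])
  finally have P_eq: "P = B\<^sup>T * M * B + C\<^sup>T * M * C" .
  have PC: "P \<in> carrier_mat N N" using P_eq BC MC by auto
  have adjC: "mat_adjoint T \<in> carrier_mat N N"
    using TC by (auto simp: mat_adjoint_def)
  \<comment> \<open>The same formula with the identity in place of \<open>M\<close> turns unitarity
    of \<open>T\<close> into a real identity.\<close>
  have one: "1\<^sub>m N = B\<^sup>T * B + C\<^sup>T * C"
  proof -
    have "map_mat complex_of_real (1\<^sub>m N) = 1\<^sub>m N" by (intro eq_matI) auto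
    moreover have "map_mat Re (1\<^sub>m N) = (1\<^sub>m N :: real mat)" by (intro eq_matI) auto
    ultimately show ?thesis
      using Re_adjoint_congruence[OF TC, of "1\<^sub>m N"] TT BC adjC
      unfolding B_def[symmetric] C_def[symmetric] by simp
  qed
  have quad: "x \<bullet> ((S\<^sup>T * M * S) *\<^sub>v x) = (S *\<^sub>v x) \<bullet> (M *\<^sub>v (S *\<^sub>v x))"
    if "S \<in> carrier_mat N N" "x \<in> carrier_vec N" for S x
  proof -
    have "(S\<^sup>T * M * S) *\<^sub>v x = S\<^sup>T *\<^sub>v (M *\<^sub>v (S *\<^sub>v x))"
      using that MC by (simp add: assoc_mult_mat_vec[of _ N N _ N])
    then have "x \<bullet> ((S\<^sup>T * M * S) *\<^sub>v x) = (S\<^sup>T *\<^sub>v (M *\<^sub>v (S *\<^sub>v x))) \<bullet> x"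
      using that MC by (simp add: comm_scalar_prod[of x N])
    also have "\<dots> = (M *\<^sub>v (S *\<^sub>v x)) \<bullet> (S *\<^sub>v x)"
      using that MC by (intro transpose_vec_mult_scalar[of _ N N]) auto
    also have "\<dots> = (S *\<^sub>v x) \<bullet> (M *\<^sub>v (S *\<^sub>v x))"
      using that MC by (intro comm_scalar_prod[of _ N]) auto
    finally show ?thesis .
  qed
  have "0 < x \<bullet> (P *\<^sub>v x)" if x: "x \<in> carrier_vec N" "x \<noteq> 0\<^sub>v N" for x
  proof -
    have split: "x \<bullet> (P *\<^sub>v x) = (B *\<^sub>v x) \<bullet> (M *\<^sub>v (B *\<^sub>v x)) + (C *\<^sub>v x) \<bullet> (M *\<^sub>v (C *\<^sub>v x))"
    proof -
      have "P *\<^sub>v x = (B\<^sup>T * M * B) *\<^sub>v x + (C\<^sup>T * M * C) *\<^sub>v x"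
        unfolding P_eq using BC MC x by (intro add_mult_distrib_mat_vec[of _ N N]) auto
      moreover have "(B\<^sup>T * M * B) *\<^sub>v x \<in> carrier_vec N" "(C\<^sup>T * M * C) *\<^sub>v x \<in> carrier_vec N"
        using BC MC x by (auto intro!: mult_mat_vec_carrier[of _ N N])
      ultimately show ?thesis
        using quad[OF BC(1) x(1)] quad[OF BC(2) x(1)] x
        by (simp add: scalar_prod_add_distrib[of _ N])
    qed
    have "x = (B\<^sup>T * B + C\<^sup>T * C) *\<^sub>v x" using one x by (metis one_mult_mat_vec)
    also have "\<dots> = B\<^sup>T *\<^sub>v (B *\<^sub>v x) + C\<^sup>T *\<^sub>v (C *\<^sub>v x)"
      using BC x by (simp add: add_mult_distrib_mat_vec[of _ N N] assoc_mult_mat_vec[of _ N N _ N])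
    finally have x_eq: "x = B\<^sup>T *\<^sub>v (B *\<^sub>v x) + C\<^sup>T *\<^sub>v (C *\<^sub>v x)" .
    \<comment> \<open>By \<open>x_eq\<close>, \<open>x\<close> is recovered from its two images, so
      they cannot both vanish. One summand in \<open>split\<close> is thus positive and the other
      nonnegative.\<close>
    have "B *\<^sub>v x \<noteq> 0\<^sub>v N \<or> C *\<^sub>v x \<noteq> 0\<^sub>v N"
    proof (rule ccontr)
      assume "\<not> ?thesis"
      then have "x = B\<^sup>T *\<^sub>v 0\<^sub>v N + C\<^sup>T *\<^sub>v 0\<^sub>v N" using x_eq by simp
      also have "\<dots> = 0\<^sub>v N" using BC by (intro eq_vecI) auto
      finally show False using x(2) by simp
    qed
    moreover have Bx: "B *\<^sub>v x \<in> carrier_vec N" "C *\<^sub>v x \<in> carrier_vec N" using BC x by auto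
    ultimately show ?thesis
      unfolding split
      using spd_mat_pos[OF M Bx(1)] spd_mat_pos[OF M Bx(2)]
        spd_mat_nonneg[OF M Bx(1)] spd_mat_nonneg[OF M Bx(2)] by fastforce
  qed
  moreover have "P\<^sup>T = P"
  proof -
    have "(S\<^sup>T * M * S)\<^sup>T = S\<^sup>T * M * S" if S: "S \<in> carrier_mat N N" for S
    proof -
      have "(S\<^sup>T * M * S)\<^sup>T = S\<^sup>T * (S\<^sup>T * M)\<^sup>T"
        using S MC by (intro transpose_mult[of _ N N _ N]) auto
      also have "(S\<^sup>T * M)\<^sup>T = M * S"
        using S MC MT by (subst transpose_mult[of _ N N _ N]) auto
      finally show ?thesis using S MC by (simp add: assoc_mult_mat[of _ N N _ N _ N])
    qed
    moreover have "P\<^sup>T = (B\<^sup>T * M * B)\<^sup>T + (C\<^sup>T * M * C)\<^sup>T"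
      unfolding P_eq using BC MC by (intro transpose_add[of _ N N]) auto
    ultimately show ?thesis using BC P_eq by simp
  qed
  ultimately show ?thesis using PC by (simp add: spd_mat_def)
qed

section \<open>Regrouping unknowns by node and definiteness of \<open>Q\<close>\<close>

lemma sum_blocks:
  fixes g :: "nat \<Rightarrow> 'a::comm_monoid_add"
  shows "(\<Sum>a = 0..<c * n. g a) = (\<Sum>i = 0..<n. \<Sum>l = 0..<c. g (l * n + i))"
proof -
  have "(\<Sum>a = 0..<c * n. g a) = (\<Sum>l<c. sum g {l * n..<l * n + n})"
    by (simp add: sum.nat_group atLeast0LessThan)
  also have "\<dots> = (\<Sum>l<c. \<Sum>i<n. g (l * n + i))"
    by (simp add: sum.shift_bounds_nat_ivl[of g 0 _ n, simplified] add.commute atLeast0LessThan)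
  finally show ?thesis by (subst sum.swap) (simp add: atLeast0LessThan)
qed

lemma block_index_less: "l < c \<Longrightarrow> i < n \<Longrightarrow> l * n + i < c * (n::nat)"
  using mult_le_mono1[of "Suc l" c n] by simp

text \<open>Regrouping the index \<open>l n + i\<close> by the node \<open>i\<close> makes \<open>Q\<close> block diagonal, with blocks
  \<open>\<Phi> (q i)\<close>.\<close>

lemma spd_mat_Q_mat:
  assumes \<Phi>: "\<And>i. i < n \<Longrightarrow> \<Phi> (q i) \<in> spd_mat c"
  shows "Q_mat c n \<Phi> q \<in> spd_mat (c * n)"
proof -
  let ?Q = "Q_mat c n \<Phi> q"
  have QC: "?Q \<in> carrier_mat (c * n) (c * n)" by (simp add: Q_mat_def)
  have \<Phi>C: "\<Phi> (q i) \<in> carrier_mat c c" if "i < n" for i using spd_mat_carrier[OF \<Phi>[OF that]] .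
  have \<Phi>T: "\<Phi> (q i) $$ (l, m) = \<Phi> (q i) $$ (m, l)" if "i < n" "l < c" "m < c" for i l m
  proof -
    have "(\<Phi> (q i))\<^sup>T $$ (m, l) = \<Phi> (q i) $$ (l, m)" using \<Phi>C[OF that(1)] that by simp
    moreover have "(\<Phi> (q i))\<^sup>T = \<Phi> (q i)" using \<Phi>[OF that(1)] by (simp add: spd_mat_def)
    ultimately show ?thesis by simp
  qed
  have entry: "?Q $$ (a, b) = (if a mod n = b mod n then \<Phi> (q (a mod n)) $$ (a div n, b div n) else 0)"
    if "a < c * n" "b < c * n" for a b
  proof -
    have "0 < n" using that by (cases n) auto
    then show ?thesis using that by (simp add: Q_mat_def D_block_def mat_diag_def)
  qed
  have "?Q\<^sup>T = ?Q"
  proof (rule eq_matI)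
    fix a b assume "a < dim_row ?Q" "b < dim_col ?Q"
    then have ab: "a < c * n" "b < c * n" by (auto simp: Q_mat_def)
    then have "0 < n" by (cases n) auto
    moreover have "a div n < c" "b div n < c" using ab by (auto simp: less_mult_imp_div_less)
    ultimately show "?Q\<^sup>T $$ (a, b) = ?Q $$ (a, b)"
      using ab QC entry[of a b] entry[of b a] \<Phi>T[of "a mod n" "a div n" "b div n"] by auto
  qed (auto simp: Q_mat_def)
  moreover have "0 < x \<bullet> (?Q *\<^sub>v x)" if x: "x \<in> carrier_vec (c * n)" "x \<noteq> 0\<^sub>v (c * n)" for x
  proof -
    \<comment> \<open>\<open>y i\<close> collects the \<open>c\<close> components of
      \<open>x\<close> that belong to node \<open>i\<close>.\<close>
    define y where "y i = vec c (\<lambda>l. x $ (l * n + i))" for i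
    have yC: "y i \<in> carrier_vec c" for i by (simp add: y_def)
    have Qx: "(?Q *\<^sub>v x) $ (l * n + i) = (\<Phi> (q i) *\<^sub>v y i) $ l" if il: "i < n" "l < c" for i l
    proof -
      note lt = block_index_less[OF il(2,1)]
      have "(?Q *\<^sub>v x) $ (l * n + i) = (\<Sum>b = 0..<c * n. ?Q $$ (l * n + i, b) * x $ b)"
        using lt QC x by (simp add: scalar_prod_def)
      also have "\<dots> = (\<Sum>j = 0..<n. \<Sum>m = 0..<c. ?Q $$ (l * n + i, m * n + j) * x $ (m * n + j))"
        by (rule sum_blocks)
      \<comment> \<open>Every block is diagonal, so different nodes do not interact.\<close>
      also have "\<dots> = (\<Sum>j = 0..<n. if i = j then \<Sum>m = 0..<c. \<Phi> (q i) $$ (l, m) * y i $ m else 0)"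
        using il lt by (intro sum.cong refl) (auto simp: entry block_index_less y_def)
      also have "\<dots> = (\<Sum>m = 0..<c. \<Phi> (q i) $$ (l, m) * y i $ m)"
        using il by simp
      also have "\<dots> = (\<Phi> (q i) *\<^sub>v y i) $ l"
        using il \<Phi>C[OF il(1)] yC[of i] by (simp add: scalar_prod_def)
      finally show ?thesis .
    qed
    have "x \<bullet> (?Q *\<^sub>v x) = (\<Sum>a = 0..<c * n. x $ a * (?Q *\<^sub>v x) $ a)"
      unfolding scalar_prod_def using QC by simp
    also have "\<dots> = (\<Sum>i = 0..<n. \<Sum>l = 0..<c. x $ (l * n + i) * (?Q *\<^sub>v x) $ (l * n + i))"
      by (rule sum_blocks)
    also have "\<dots> = (\<Sum>i = 0..<n. y i \<bullet> (\<Phi> (q i) *\<^sub>v y i))"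
    proof (intro sum.cong refl)
      fix i assume "i \<in> {0..<n}"
      then have i: "i < n" by simp
      then have "dim_vec (\<Phi> (q i) *\<^sub>v y i) = c" using \<Phi>C by auto
      then show "(\<Sum>l = 0..<c. x $ (l * n + i) * (?Q *\<^sub>v x) $ (l * n + i)) =
          y i \<bullet> (\<Phi> (q i) *\<^sub>v y i)"
        unfolding scalar_prod_def using i by (intro sum.cong) (auto simp: Qx y_def)
    qed
    finally have quad: "x \<bullet> (?Q *\<^sub>v x) = (\<Sum>i = 0..<n. y i \<bullet> (\<Phi> (q i) *\<^sub>v y i))" .
    \<comment> \<open>The node of a nonzero entry of \<open>x\<close> supplies one strictly positive
      term in \<open>quad\<close>; the other terms are nonnegative.\<close>
    obtain a where a: "a < c * n" "x $ a \<noteq> 0"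
      using x by (metis carrier_vecD eq_vecI index_zero_vec(1) index_zero_vec(2))
    then have "0 < n" by (cases n) auto
    define i where "i = a mod n"
    have i: "i < n" using \<open>0 < n\<close> by (simp add: i_def)
    have l: "a div n < c" using a by (simp add: less_mult_imp_div_less)
    have "y i $ (a div n) \<noteq> 0" using l a by (simp add: y_def i_def)
    then have "y i \<noteq> 0\<^sub>v c" using l by auto
    then have "0 < y i \<bullet> (\<Phi> (q i) *\<^sub>v y i)" by (rule spd_mat_pos[OF \<Phi>[OF i] yC])
    then show ?thesis
      unfolding quad using i spd_mat_nonneg[OF \<Phi> yC] by (intro sum_pos2[of _ i]) auto
  qed
  ultimately show ?thesis using QC by (simp add: spd_mat_def)
qed

section \<open>The local matrices of the parametrization\<close>

lemma conj_mode_conj_mode [simp]: "conj_mode (conj_mode k) = k"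
  by (rule eq_vecI) (auto simp: conj_mode_def)

text \<open>\<open>K_tilde\<close> may be zero, but the summand \<psi> (\<theta> 0) is always
  positive definite.\<close>

lemma Phi_tilde_spd:
  assumes \<psi>: "\<psi> \<in> carrier_vec C \<rightarrow> spd_mat c"
    and ks: "inj_on ks {1..kmax}"
    and Kc: "Kc \<subseteq> conj_mode ` ks ` {1..kmax}"
    and \<theta>: "\<And>j. j \<in> {0..kmax} \<Longrightarrow> \<theta> j \<in> carrier_vec C"
  shows "Phi_tilde c \<psi> kmax ks Kc \<theta> k \<in> spd_mat c"
proof -
  have \<psi>\<theta>: "\<psi> (\<theta> j) \<in> spd_mat c" if "j \<in> {0..kmax}" for j using \<psi> \<theta>[OF that] by auto
  \<comment> \<open>Injectivity makes the selected index unique, so that \<open>THE\<close> denotes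
    an actual index, whose weight lies in the domain of \<psi>.\<close>
  have THE_mem: "(THE j. j \<in> {1..kmax} \<and> k = g j) \<in> {0..kmax}"
    if "inj_on g {1..kmax}" "k \<in> g ` {1..kmax}" for g :: "nat \<Rightarrow> int vec"
  proof -
    have "\<exists>!j. j \<in> {1..kmax} \<and> k = g j" using that by (metis imageE inj_onD)
    from theI'[OF this] show ?thesis by auto
  qed
  \<comment> \<open>An involution is injective, so the selection is also unique for conjugated
    modes.\<close>
  have "inj_on (\<lambda>j. conj_mode (ks j)) {1..kmax}"
    using ks by (metis (no_types, lifting) conj_mode_conj_mode inj_on_def)
  then have "K_tilde c \<psi> kmax ks Kc \<theta> k \<in> insert (0\<^sub>m c c) (spd_mat c)"
    using \<psi>\<theta>[OF THE_mem[of ks]] \<psi>\<theta>[OF THE_mem[of "\<lambda>j. conj_mode (ks j)"]] ks Kc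
    by (auto simp: K_tilde_def image_image)
  moreover have "\<psi> (\<theta> 0) \<in> spd_mat c" by (rule \<psi>\<theta>) simp
  ultimately show ?thesis
    using spd_mat_add spd_mat_carrier by (fastforce simp: Phi_tilde_def)
qed

theorem mainTheorem2:
  fixes c n d kmax :: nat
    and \<psi> :: "real vec \<Rightarrow> real mat"
    and ks q :: "nat \<Rightarrow> int vec"
    and Kc :: "int vec set"
    and \<theta> :: "nat \<Rightarrow> real vec"
    and T :: "complex mat"
    and P :: "real mat"
  assumes "0 < d"
    and "\<psi> \<in> carrier_vec (c * (c + 1) div 2) \<rightarrow> spd_mat c"
    and "\<And>j. j \<in> {1..kmax} \<Longrightarrow> ks j \<in> carrier_vec d"
    and "inj_on ks {1..kmax}"
    and "Kc \<subseteq> conj_mode ` ks ` {1..kmax} - ks ` {1..kmax}"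
    and "\<And>j. j \<in> {0..kmax} \<Longrightarrow> \<theta> j \<in> carrier_vec (c * (c + 1) div 2)"
    and "\<And>i. i < n \<Longrightarrow> q i \<in> carrier_vec d"
    and "unitary_mat (c * n) T"
    and "map_mat complex_of_real P =
           UNO_precond T (Q_mat c n (Phi_tilde c \<psi> kmax ks Kc \<theta>) q)"
  shows "P \<in> spd_mat (c * n) \<and>
    (\<forall>A f u0. A \<in> spd_mat (c * n) \<longrightarrow> f \<in> carrier_vec (c * n) \<longrightarrow> u0 \<in> carrier_vec (c * n) \<longrightarrow>
      (\<exists>m \<le> c * n. \<exists>u r dir \<gamma>.
         (pcg_iteration A P ^^ m) (pcg_init (c * n) A f u0) (u, r, dir, \<gamma>) \<and>
         r = 0\<^sub>v (c * n) \<and>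
         {v \<in> carrier_vec (c * n). A *\<^sub>v v = f} = {u}))"
proof -
  have "P \<in> spd_mat (c * n)"
    using assms by (intro spd_mat_unitary_congruence[OF assms(8) _ assms(9)] spd_mat_Q_mat
        Phi_tilde_spd[OF assms(2,4)]) auto
  then show ?thesis
    by (intro conjI allI impI spd_pcg.pcg_terminates spd_pcg.intro)
qed

end
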